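(* Let $\Theta=(\Gamma,(x_{k,i}))$ be a patch framework in $\mathbb{R}^d$ with $\Gamma$ connected and with every view affinely non-degenerate. A perfect alignment $S$ is unique if $|\overline{\mathbb{G}}^*(S)|=1$.
   Context: Patch framework. $\Gamma$ is a bipartite graph on $n+m$ vertices; vertex $k\in\{1,\dots,n\}$ represents the $k$th point and vertex $n+i$, $i\in\{1,\dots,m\}$, the $i$th view; $(k,i)\in E(\Gamma)$ means that point $k$ is in view $i$, with local coordinates $x_{k,i}\in\mathbb{R}^d$. The tuple $\Theta=(\Gamma,(x_{k,i}))$ is a patch framework. A view $i$ is affinely non-degenerate if it has at least $d+1$ points and the affine span of $\{x_{k,i}:(k,i)\in E(\Gamma)\}$ has dimension $d$. Put $e_{ki}=e_k-e_{n+i}\in\mathbb{R}^{n+m}$, $\varepsilon_i$ the $i$th standard basis vector of $\mathbb{R}^m$, $\mathcal{L}_\Gamma=\sum_{(k,i)\in E(\Gamma)}e_{ki}e_{ki}^T$, $B=\sum_{(k,i)\in E(\Gamma)}(\varepsilon_i\otimes I_d)x_{k,i}e_{ki}^T$, $D=\sum_{(k,i)\in E(\Gamma)}(\varepsilon_i\otimes I_d)x_{k,i}x_{k,i}^T(\varepsilon_i\otimes I_d)^T$, and $C=D-B\mathcal{L}_\Gamma^\dagger B^T\in\mathbb{R}^{md\times md}$ (positive semi-definite), where $\dagger$ is the Moore–Penrose pseudoinverse. An alignment is an element $S=[S_i]_1^m$ (vertical stack) of $\mathbb{O}(d)^m\subseteq\mathbb{R}^{md\times d}$; $F(S)=\mathrm{Tr}(CSS^T)$;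 $S$ is perfect if $F(S)=0$ (hence optimal, i.e. a global minimizer of $F$). An optimal alignment $S$ is unique if every other optimal alignment $O$ is of the form $O=SQ$ for some $Q\in\mathbb{O}(d)$. The graph $\overline{\mathbb{G}}$. For a collection of views, two views $i\neq j$ are joined by an edge of $\overline{\mathbb{G}}$ iff $\mathrm{rank}(\overline B_{i,j})=d$, where $B_{i,j}$ has as columns the local coordinates in view $i$ of the points common to views $i$ and $j$, $n'$ is the number of these points, and $\overline B_{i,j}=B_{i,j}(I_{n'}-(1/n')\mathbf{1}_{n'}\mathbf{1}_{n'}^T)$ ($\mathbf{1}_{n'}$ the all-ones vector). For perfectly alignable views this condition is symmetric in $i,j$. Coarsening. Given a perfect alignment $S$, let $H=S^TB\mathcal{L}_\Gamma^\dagger(I_{n+m}-n^{-1}\mathbf{1}^{n+m}_n\mathbf{1}_{n+m}^T)$, where $\mathbf{1}^{n+m}_n$ has first $n$ entries $1$ and the rest $0$, and let $t_i$ be column $n+i$ of $H$. (i) Transform all views using $S$ and $t$: replace $x_{k,i}$ by $S_i^Tx_{k,i}+t_i$ (since $S$ is perfect, the coordinates of a point then agree in all views containing it). (ii) Merge the views that lie in the same connected component of $\overline{\mathbb{G}}$, replacing them by a single view (containing the union of their points, with these common coordinates). (iii) Construct, in the same manner as $\overline{\mathbb{G}}$, the graph associated with the new set of views. (iv) Repeat from (ii) until no further merging occurs. $\overline{\mathbb{G}}^*(S)$ is the final graph over the remaining views, and $|\overline{\mathbb{G}}^*(S)|$ is its number of vertices. *)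

theory Defs
  imports "HOL-Analysis.Analysis" "HOL-Library.While_Combinator"
begin

(* Points, views and coordinates are indexed by finite types 'n, 'm and 'd, so that
   n = CARD('n), m = CARD('m), d = CARD('d).  The n + m vertices of the bipartite graph are the
   elements of 'n + 'm (Inl k is the k-th point, Inr i the i-th view), and the rows of a stack of
   m blocks of height d are indexed by 'm \<times> 'd.  A patch framework is a pair (\<Gamma>, x), where
   \<Gamma> :: ('n \<times> 'm) set is the edge set and x k i is the local coordinate of point k in view i;
   x k i is never used unless (k, i) \<in> \<Gamma>. *)

subsection \<open>Linear algebra\<close>

definition outer :: "real^'a \<Rightarrow> real^'b \<Rightarrow> real^'b^'a" where
  "outer u v = (\<chi> p q. u $ p * v $ q)"

(* Moore--Penrose pseudoinverse, given by the four Penrose conditions *)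
definition pinv :: "real^'a^'b \<Rightarrow> real^'b^'a" where
  "pinv A = (THE X. A ** X ** A = A \<and> X ** A ** X = X \<and>
                    transpose (A ** X) = A ** X \<and> transpose (X ** A) = X ** A)"

(* \<epsilon>\<^sub>i \<otimes> I\<^sub>d as an md \<times> d matrix *)
definition eps_kron_id :: "'m::finite \<Rightarrow> real^'d^('m \<times> 'd)" where
  "eps_kron_id i = (\<chi> r c. axis i (1::real) $ fst r * (mat 1 :: real^'d^'d) $ snd r $ c)"

subsection \<open>Graphs\<close>

definition linked :: "('v \<times> 'v) set \<Rightarrow> ('v \<times> 'v) set" where
  "linked R = (R \<union> R\<inverse>)\<^sup>*"

(* A graph is a pair of a vertex set and an adjacency relation, read as undirected. *)
type_synonym 'v ugraph = "'v set \<times> ('v \<times> 'v) set"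

definition conn_comps :: "'v ugraph \<Rightarrow> 'v set set" where
  "conn_comps G = {{v \<in> fst G. (u, v) \<in> linked (snd G)} | u. u \<in> fst G}"

definition bipartite_connected :: "('n \<times> 'm) set \<Rightarrow> bool" where
  "bipartite_connected \<Gamma> \<longleftrightarrow>
     (\<forall>u v :: 'n + 'm. (u, v) \<in> linked {(Inl k, Inr i) | k i. (k, i) \<in> \<Gamma>})"

subsection \<open>Patch frameworks and alignments\<close>

definition affinely_nondegenerate ::
  "('n::finite \<times> 'm) set \<Rightarrow> ('n \<Rightarrow> 'm \<Rightarrow> real^'d) \<Rightarrow> 'm \<Rightarrow> bool" where
  "affinely_nondegenerate \<Gamma> x i \<longleftrightarrow>
     card {k. (k, i) \<in> \<Gamma>} \<ge> CARD('d) + 1 \<and>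
     aff_dim (affine hull {x k i | k. (k, i) \<in> \<Gamma>}) = int CARD('d)"

definition evec :: "'n::finite \<Rightarrow> 'm::finite \<Rightarrow> real^('n + 'm)" where
  "evec k i = axis (Inl k) 1 - axis (Inr i) 1"

definition Lap :: "('n::finite \<times> 'm::finite) set \<Rightarrow> real^('n + 'm)^('n + 'm)" where
  "Lap \<Gamma> = (\<Sum>(k, i)\<in>\<Gamma>. outer (evec k i) (evec k i))"

definition Bmat ::
  "('n::finite \<times> 'm::finite) set \<Rightarrow> ('n \<Rightarrow> 'm \<Rightarrow> real^'d) \<Rightarrow> real^('n + 'm)^('m \<times> 'd)" where
  "Bmat \<Gamma> x = (\<Sum>(k, i)\<in>\<Gamma>. eps_kron_id i ** outer (x k i) (evec k i))"

definition Dmat ::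
  "('n::finite \<times> 'm::finite) set \<Rightarrow> ('n \<Rightarrow> 'm \<Rightarrow> real^'d) \<Rightarrow> real^('m \<times> 'd)^('m \<times> 'd)" where
  "Dmat \<Gamma> x = (\<Sum>(k, i)\<in>\<Gamma>.
     eps_kron_id i ** outer (x k i) (x k i) ** transpose (eps_kron_id i))"

definition Cmat ::
  "('n::finite \<times> 'm::finite) set \<Rightarrow> ('n \<Rightarrow> 'm \<Rightarrow> real^'d) \<Rightarrow> real^('m \<times> 'd)^('m \<times> 'd)" where
  "Cmat \<Gamma> x = Dmat \<Gamma> x - Bmat \<Gamma> x ** pinv (Lap \<Gamma>) ** transpose (Bmat \<Gamma> x)"

definition block :: "real^'d^('m::finite \<times> 'd) \<Rightarrow> 'm \<Rightarrow> real^'d^'d" where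
  "block S i = (\<chi> a b. S $ (i, a) $ b)"

definition alignment :: "real^'d^('m::finite \<times> 'd) \<Rightarrow> bool" where
  "alignment S \<longleftrightarrow> (\<forall>i. orthogonal_matrix (block S i))"

definition objective ::
  "('n::finite \<times> 'm::finite) set \<Rightarrow> ('n \<Rightarrow> 'm \<Rightarrow> real^'d) \<Rightarrow> real^'d^('m \<times> 'd) \<Rightarrow> real" where
  "objective \<Gamma> x S = trace (Cmat \<Gamma> x ** S ** transpose S)"

definition perfect_alignment ::
  "('n::finite \<times> 'm::finite) set \<Rightarrow> ('n \<Rightarrow> 'm \<Rightarrow> real^'d) \<Rightarrow> real^'d^('m \<times> 'd) \<Rightarrow> bool" where
  "perfect_alignment \<Gamma> x S \<longleftrightarrow> alignment S \<and> objective \<Gamma> x S = 0"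

definition optimal_alignment ::
  "('n::finite \<times> 'm::finite) set \<Rightarrow> ('n \<Rightarrow> 'm \<Rightarrow> real^'d) \<Rightarrow> real^'d^('m \<times> 'd) \<Rightarrow> bool" where
  "optimal_alignment \<Gamma> x S \<longleftrightarrow>
     alignment S \<and> (\<forall>T. alignment T \<longrightarrow> objective \<Gamma> x S \<le> objective \<Gamma> x T)"

definition unique_alignment ::
  "('n::finite \<times> 'm::finite) set \<Rightarrow> ('n \<Rightarrow> 'm \<Rightarrow> real^'d) \<Rightarrow> real^'d^('m \<times> 'd) \<Rightarrow> bool" where
  "unique_alignment \<Gamma> x S \<longleftrightarrow>
     optimal_alignment \<Gamma> x S \<and>
     (\<forall>T. optimal_alignment \<Gamma> x T \<longrightarrow> (\<exists>Q. orthogonal_matrix Q \<and> T = S ** Q))"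

subsection \<open>The overlap graph of a collection of views\<close>

(* A collection of views is given by a set of view names V, the set P v of the points in view v and
   the coordinates z k v of point k in view v. *)

(* B\<^sub>u\<^sub>v, with columns indexed by all points: the columns of points not common to u and v are
   padded with zeros. *)
definition overlap_mat ::
  "('v \<Rightarrow> 'n set) \<Rightarrow> ('n::finite \<Rightarrow> 'v \<Rightarrow> real^'d) \<Rightarrow> 'v \<Rightarrow> 'v \<Rightarrow> real^'n^'d" where
  "overlap_mat P z u v = (\<chi> a k. if k \<in> P u \<inter> P v then z k u $ a else 0)"

(* I - (1/n') 1 1\<^sup>T with n' = card K and 1 the indicator vector of K.  On the columns in K this is
   the n' \<times> n' centering matrix; on the others it is the identity, so the zero columns of
   overlap_mat stay zero and the rank is that of the unpadded product. *)
definition centering :: "'n::finite set \<Rightarrow> real^'n^'n" where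
  "centering K =
     mat 1 - (1 / real (card K)) *\<^sub>R outer (\<chi> k. indicator K k) (\<chi> k. indicator K k)"

definition overlap_graph ::
  "'v set \<Rightarrow> ('v \<Rightarrow> 'n set) \<Rightarrow> ('n::finite \<Rightarrow> 'v \<Rightarrow> real^'d) \<Rightarrow> 'v ugraph" where
  "overlap_graph V P z =
     (V, {(u, v). u \<in> V \<and> v \<in> V \<and> u \<noteq> v \<and>
            rank (overlap_mat P z u v ** centering (P u \<inter> P v)) = CARD('d)})"

subsection \<open>Coarsening\<close>

definition Hmat :: "('n::finite \<times> 'm::finite) set \<Rightarrow> ('n \<Rightarrow> 'm \<Rightarrow> real^'d) \<Rightarrow>
    real^'d^('m \<times> 'd) \<Rightarrow> real^('n + 'm)^'d" where
  "Hmat \<Gamma> x S = transpose S ** Bmat \<Gamma> x ** pinv (Lap \<Gamma>) **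
     (mat 1 - (1 / real CARD('n)) *\<^sub>R
        outer (\<chi> p. case p of Inl k \<Rightarrow> 1 | Inr i \<Rightarrow> 0) (\<chi> p. 1))"

definition transformed :: "('n::finite \<times> 'm::finite) set \<Rightarrow> ('n \<Rightarrow> 'm \<Rightarrow> real^'d) \<Rightarrow>
    real^'d^('m \<times> 'd) \<Rightarrow> 'n \<Rightarrow> 'm \<Rightarrow> real^'d" where
  "transformed \<Gamma> x S k i = transpose (block S i) *v x k i + column (Inr i) (Hmat \<Gamma> x S)"

(* A view arising during the coarsening is named by the set of original views merged into it;
   the initial views are the singletons. *)

definition merged_points :: "('n \<times> 'm) set \<Rightarrow> 'm set \<Rightarrow> 'n set" where
  "merged_points \<Gamma> A = {k. \<exists>i\<in>A. (k, i) \<in> \<Gamma>}"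

(* For perfect S all views in A that contain k assign the same transformed coordinates to k, so
   the choice of the view is immaterial. *)
definition merged_coord :: "('n::finite \<times> 'm::finite) set \<Rightarrow> ('n \<Rightarrow> 'm \<Rightarrow> real^'d) \<Rightarrow>
    real^'d^('m \<times> 'd) \<Rightarrow> 'n \<Rightarrow> 'm set \<Rightarrow> real^'d" where
  "merged_coord \<Gamma> x S k A = transformed \<Gamma> x S k (SOME i. i \<in> A \<and> (k, i) \<in> \<Gamma>)"

definition view_graph :: "('n::finite \<times> 'm::finite) set \<Rightarrow> ('n \<Rightarrow> 'm \<Rightarrow> real^'d) \<Rightarrow>
    real^'d^('m \<times> 'd) \<Rightarrow> 'm set set \<Rightarrow> 'm set ugraph" where
  "view_graph \<Gamma> x S V = overlap_graph V (merged_points \<Gamma>) (merged_coord \<Gamma> x S)"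

definition merge_views :: "('n::finite \<times> 'm::finite) set \<Rightarrow> ('n \<Rightarrow> 'm \<Rightarrow> real^'d) \<Rightarrow>
    real^'d^('m \<times> 'd) \<Rightarrow> 'm set set \<Rightarrow> 'm set set" where
  "merge_views \<Gamma> x S V = Union ` conn_comps (view_graph \<Gamma> x S V)"

(* The loop terminates: as long as merging occurs, the number of views drops. *)
definition final_views :: "('n::finite \<times> 'm::finite) set \<Rightarrow> ('n \<Rightarrow> 'm \<Rightarrow> real^'d) \<Rightarrow>
    real^'d^('m \<times> 'd) \<Rightarrow> 'm set set" where
  "final_views \<Gamma> x S =
     while (\<lambda>V. merge_views \<Gamma> x S V \<noteq> V) (merge_views \<Gamma> x S) (range (\<lambda>i. {i}))"

definition coarse_graph :: "('n::finite \<times> 'm::finite) set \<Rightarrow> ('n \<Rightarrow> 'm \<Rightarrow> real^'d) \<Rightarrow>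
    real^'d^('m \<times> 'd) \<Rightarrow> 'm set ugraph" where
  "coarse_graph \<Gamma> x S = view_graph \<Gamma> x S (final_views \<Gamma> x S)"

definition num_vertices :: "'v ugraph \<Rightarrow> nat" where
  "num_vertices G = card (fst G)"

end

theory Submission
  imports Defs
begin

text \<open>
  With \<open>W = S\<^sup>T B L\<^sup>\<dagger>\<close> the objective equals the residual
  \<open>\<Sum> \<parallel>S\<^sub>i\<^sup>T x\<^sub>k\<^sub>i - W e\<^sub>k\<^sub>i\<parallel>\<^sup>2\<close>, so a perfect alignment is optimal, every optimal alignment
  \<open>T\<close> is perfect, and each of them realises all views as rigid images of one configuration.
  Hence each view \<open>i\<close> carries a single rigid motion \<open>g i\<close> that takes the configuration of \<open>S\<close> to
  that of \<open>T\<close> on the points of the view.  Two views whose common points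
  affinely span the space have the same \<open>g\<close>, so \<open>g\<close> is constant on every view that arises in the coarsening.
  If a single view is left, \<open>g\<close> is constant, and its linear part gives \<open>Q\<close>.
\<close>

section \<open>Rank-one matrices\<close>

(* Rewrites transpose A *v x to x v* A, which none of the rules below match. *)
declare transpose_matrix_vector [simp del]

lemma matrix_mult_outer: "A ** outer u v = outer (A *v u) v"
  by (simp add: outer_def matrix_matrix_mult_def matrix_vector_mult_def vec_eq_iff
      sum_distrib_right mult.assoc)

lemma outer_matrix_mult: "outer u v ** A = outer u (transpose A *v v)"
  by (simp add: outer_def matrix_matrix_mult_def matrix_vector_mult_def vec_eq_iff
      transpose_def sum_distrib_left mult_ac)

lemma transpose_outer: "transpose (outer u v) = outer v u"
  by (simp add: outer_def transpose_def vec_eq_iff mult.commute)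

lemma outer_matrix_vector_mult: "outer u v *v w = (v \<bullet> w) *\<^sub>R u"
  by (simp add: outer_def matrix_vector_mult_def vec_eq_iff inner_vec_def
      sum_distrib_left sum_distrib_right mult_ac)

lemma trace_outer: "trace (outer u v) = u \<bullet> v"
  by (simp add: outer_def trace_def inner_vec_def)

lemma outer_zero_right: "outer u 0 = 0"
  by (simp add: outer_def vec_eq_iff)

lemma matrix_add_rdistrib: "(A + B) ** C = A ** C + B ** C"
  by (simp add: matrix_matrix_mult_def vec_eq_iff distrib_right sum.distrib)

lemma matrix_sub_ldistrib: "A ** (B - C) = A ** B - A ** (C :: 'a::ring_1^'n^'m)"
  by (simp add: matrix_matrix_mult_def vec_eq_iff right_diff_distrib sum_subtractf)

lemma matrix_sub_rdistrib: "(A - B) ** C = A ** C - B ** (C :: 'a::ring_1^'n^'m)"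
  by (simp add: matrix_matrix_mult_def vec_eq_iff left_diff_distrib sum_subtractf)

lemma matrix_mult_scaleR: "A ** (c *\<^sub>R B) = c *\<^sub>R (A ** (B :: real^'n^'m))"
  by (simp add: matrix_matrix_mult_def vec_eq_iff sum_distrib_left mult_ac)

lemma sum_matrix_mult:
  fixes A :: "'b \<Rightarrow> real^'a^'c"
  shows "(\<Sum>i\<in>I. A i) ** M = (\<Sum>i\<in>I. A i ** M)"
  by (induction I rule: infinite_finite_induct) (simp_all add: matrix_add_rdistrib)

lemma matrix_mult_sum:
  fixes A :: "'b \<Rightarrow> real^'a^'c"
  shows "M ** (\<Sum>i\<in>I. A i) = (\<Sum>i\<in>I. M ** A i)"
  by (induction I rule: infinite_finite_induct) (simp_all add: matrix_add_ldistrib)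

lemma transpose_zero: "transpose 0 = 0"
  by (simp add: transpose_def vec_eq_iff)

lemma transpose_add: "transpose (A + B) = transpose A + transpose B"
  by (simp add: transpose_def vec_eq_iff)

lemma transpose_diff: "transpose (A - B) = transpose A - transpose B"
  by (simp add: transpose_def vec_eq_iff)

lemma transpose_sum:
  fixes A :: "'b \<Rightarrow> real^'a^'c"
  shows "transpose (\<Sum>i\<in>I. A i) = (\<Sum>i\<in>I. transpose (A i))"
  by (simp add: vec_eq_iff transpose_def)

lemma trace_sum:
  fixes A :: "'b \<Rightarrow> real^'a^'a"
  shows "trace (\<Sum>i\<in>I. A i) = (\<Sum>i\<in>I. trace (A i))"
  by (induction I rule: infinite_finite_induct) (simp_all add: trace_add trace_0[unfolded mat_0])

lemma sum_matrix_vector_mult: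
  fixes A :: "'b \<Rightarrow> real^'a^'c"
  shows "(\<Sum>i\<in>I. A i) *v w = (\<Sum>i\<in>I. A i *v w)"
  by (induction I rule: infinite_finite_induct) (simp_all add: matrix_vector_mult_add_rdistrib)

section \<open>The pseudoinverse of the Laplacian\<close>

definition penrose :: "real^'a^'b \<Rightarrow> real^'b^'a \<Rightarrow> bool" where
  "penrose A X \<longleftrightarrow> A ** X ** A = A \<and> X ** A ** X = X \<and>
     transpose (A ** X) = A ** X \<and> transpose (X ** A) = X ** A"

text \<open>Writing \<open>A ** X\<close> as AYAX, a product of the symmetric factors AY and AX, and
  transposing gives AXAY, which is AY. In the same way XA = YA, and then X = XAX = YAX = YAY =
  Y.\<close>

lemma penrose_unique:
  assumes X: "penrose A X" and Y: "penrose A Y"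
  shows "X = Y"
proof -
  have "A ** X = transpose (A ** X)"
    using X by (simp add: penrose_def)
  also have "\<dots> = transpose ((A ** Y) ** (A ** X))"
    using Y by (simp add: penrose_def matrix_mul_assoc)
  also have "\<dots> = (A ** X) ** (A ** Y)"
    using X Y unfolding matrix_transpose_mul[of "A ** Y"] by (simp add: penrose_def)
  also have "\<dots> = A ** Y"
    using X by (simp add: penrose_def matrix_mul_assoc)
  finally have AX: "A ** X = A ** Y" .
  have "X ** A = transpose (X ** A)"
    using X by (simp add: penrose_def)
  also have "\<dots> = transpose ((X ** A) ** (Y ** A))"
    using Y by (simp add: penrose_def flip: matrix_mul_assoc)
  also have "\<dots> = (Y ** A) ** (X ** A)"
    using X Y unfolding matrix_transpose_mul[of "X ** A"] by (simp add: penrose_def)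
  also have "\<dots> = Y ** A"
    using X by (simp add: penrose_def flip: matrix_mul_assoc)
  finally have XA: "X ** A = Y ** A" .
  have "X = X ** A ** X"
    using X by (simp add: penrose_def)
  also have "\<dots> = Y ** (A ** X)"
    by (simp add: XA matrix_mul_assoc)
  also have "\<dots> = Y"
    using Y by (simp add: AX matrix_mul_assoc penrose_def)
  finally show ?thesis .
qed

lemma pinv_eqI: "penrose A X \<Longrightarrow> pinv A = X"
  unfolding pinv_def penrose_def[symmetric] by (rule the_equality) (auto intro: penrose_unique)

text \<open>Adding the orthogonal projection \<open>P\<close> onto its kernel makes \<open>A\<close> invertible, and
  \<open>(A + P)\<^sup>-\<^sup>1 - P\<close> is the pseudoinverse.\<close>

lemma penrose_symmetric_exists:
  fixes A P :: "real^'a^'a"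
  assumes A: "transpose A = A" and P: "transpose P = P" "P ** P = P" "A ** P = 0"
    and ker: "\<And>v. A *v v = 0 \<Longrightarrow> P *v v = v"
  obtains X where "penrose A X" "transpose X = X"
proof -
  have PA: "P ** A = 0"
    using arg_cong[OF P(3), of transpose] A P(1)
    by (simp add: matrix_transpose_mul transpose_zero)
  \<comment> \<open>Multiplying by \<open>P\<close> removes the part coming from \<open>A\<close>,
    so \<open>P *v v\<close> vanishes, then \<open>A *v v\<close> does too, and \<open>ker\<close>
    identifies \<open>v\<close> with \<open>P *v v\<close>.\<close>
  have "v = 0" if "(A + P) *v v = 0" for v
  proof -
    have "P *v v = (P ** (A + P)) *v v"
      by (simp add: matrix_add_ldistrib PA P)
    also have "\<dots> = 0"
      using that by (simp flip: matrix_vector_mul_assoc)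
    finally have "P *v v = 0" .
    moreover from this that have "A *v v = 0"
      by (simp add: matrix_vector_mult_add_rdistrib)
    ultimately show ?thesis
      using ker by metis
  qed
  then obtain Z where ZA: "Z ** (A + P) = mat 1"
    using matrix_left_invertible_ker by blast
  then have AZ: "(A + P) ** Z = mat 1"
    by (rule matrix_left_right_inverse[THEN iffD1])
  have "transpose Z ** (A + P) = mat 1"
    using arg_cong[OF AZ, of transpose] A P(1)
    by (simp add: matrix_transpose_mul transpose_add)
  then have symZ: "transpose Z = Z"
    using AZ ZA by (metis matrix_mul_assoc matrix_mul_lid matrix_mul_rid)
  \<comment> \<open>\<open>A + P\<close> fixes the range of \<open>P\<close>, hence so does its
    inverse \<open>Z\<close>. This turns both \<open>A ** X\<close> and \<open>X ** A\<close> into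
    the complementary projection \<open>mat 1 - P\<close>.\<close>
  have ZP: "Z ** P = P"
    using ZA P by (metis add_0 matrix_add_rdistrib matrix_mul_assoc matrix_mul_lid)
  have PZ: "P ** Z = P"
    using arg_cong[OF ZP, of transpose] symZ P(1) by (simp add: matrix_transpose_mul)
  define X where "X = Z - P"
  have AX: "A ** X = mat 1 - P"
    using AZ PZ P(3) unfolding X_def
    by (simp add: matrix_sub_ldistrib matrix_add_rdistrib eq_diff_eq)
  have XA: "X ** A = mat 1 - P"
    using ZA ZP PA unfolding X_def
    by (simp add: matrix_sub_rdistrib matrix_add_ldistrib eq_diff_eq)
  have symm: "transpose (mat 1 - P) = mat 1 - P"
    using P(1) by (simp add: transpose_diff)
  have "penrose A X"
    unfolding penrose_def AX XA
    using PA PZ P(2) symm by (simp add: X_def matrix_sub_ldistrib matrix_sub_rdistrib)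
  moreover have "transpose X = X"
    using symZ P(1) by (simp add: X_def transpose_diff)
  ultimately show ?thesis
    by (rule that)
qed

section \<open>The Laplacian of a connected graph and its kernel\<close>

lemma linked_const:
  assumes "(u, v) \<in> linked R" and "\<And>a b. (a, b) \<in> R \<Longrightarrow> f a = f b"
  shows "f u = f v"
  using assms(1) unfolding linked_def
  by (induction rule: rtrancl_induct) (auto dest: assms(2))

lemma transpose_Lap: "transpose (Lap \<Gamma>) = Lap \<Gamma>"
  by (simp add: Lap_def transpose_sum transpose_outer case_prod_beta)

lemma evec_inner: "evec k i \<bullet> v = v $ Inl k - v $ Inr i"
  by (simp add: evec_def inner_diff_left inner_axis')

lemma Lap_quadratic_form:
  "v \<bullet> (Lap \<Gamma> *v v) = (\<Sum>(k, i)\<in>\<Gamma>. (evec k i \<bullet> v)\<^sup>2)"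
  by (simp add: Lap_def sum_matrix_vector_mult outer_matrix_vector_mult inner_sum_right
      case_prod_beta power2_eq_square inner_commute)

text \<open>The quadratic form is a sum of squared differences along edges, so a kernel vector
  agrees at both ends of each edge, and connectedness spreads this to all vertices.\<close>

lemma Lap_kernel:
  fixes \<Gamma> :: "('n::finite \<times> 'm::finite) set"
  assumes conn: "bipartite_connected \<Gamma>" and ker: "Lap \<Gamma> *v v = 0"
  shows "v $ p = v $ q"
proof (rule linked_const[where f = "\<lambda>p. v $ p"])
  show "(p, q) \<in> linked {(Inl k, Inr i) | k i. (k, i) \<in> \<Gamma>}"
    using conn by (simp add: bipartite_connected_def)
  have "(\<Sum>(k, i)\<in>\<Gamma>. (evec k i \<bullet> v)\<^sup>2) = 0"
    using ker by (simp flip: Lap_quadratic_form)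
  then have "evec k i \<bullet> v = 0" if "(k, i) \<in> \<Gamma>" for k i
    using that by (subst (asm) sum_nonneg_eq_0_iff) auto
  then show "v $ a = v $ b" if "(a, b) \<in> {(Inl k, Inr i) | k i. (k, i) \<in> \<Gamma>}" for a b
    using that by (auto simp: evec_inner)
qed

lemma pinv_Lap:
  fixes \<Gamma> :: "('n::finite \<times> 'm::finite) set"
  assumes conn: "bipartite_connected \<Gamma>"
  shows "penrose (Lap \<Gamma>) (pinv (Lap \<Gamma>))" "transpose (pinv (Lap \<Gamma>)) = pinv (Lap \<Gamma>)"
proof -
  define N where "N = real CARD('n + 'm)"
  \<comment> \<open>The averaging matrix is the orthogonal projection onto the constant vectors,
    which form the kernel because the graph is connected.\<close>
  define P :: "real^('n + 'm)^('n + 'm)" where "P = (\<chi> p q. 1 / N)"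
  have N: "N \<noteq> 0"
    by (simp add: N_def add_nonneg_eq_0_iff)
  have P: "P *v v = (\<chi> p. (\<Sum>q\<in>UNIV. v $ q) / N)" for v
    by (simp add: P_def matrix_vector_mult_def vec_eq_iff sum_divide_distrib)
  have sumN: "(\<Sum>q\<in>(UNIV :: ('n + 'm) set). c) = N * c" for c :: real
    by (simp add: N_def)
  have "transpose P = P"
    by (simp add: P_def transpose_def)
  moreover have "P ** P = P"
    unfolding P_def matrix_matrix_mult_def using N by (simp add: sumN vec_eq_iff del: sum_constant)
  moreover have "Lap \<Gamma> ** P = 0"
  proof -
    have "evec k i \<bullet> (P *v v) = 0" for k i v
      by (simp add: evec_inner P)
    then have "Lap \<Gamma> *v (P *v v) = 0" for v
      by (simp add: Lap_def sum_matrix_vector_mult outer_matrix_vector_mult case_prod_beta)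
    then show ?thesis
      by (simp add: matrix_eq matrix_vector_mul_assoc)
  qed
  moreover have "P *v v = v" if ker: "Lap \<Gamma> *v v = 0" for v
  proof -
    have "(\<Sum>q\<in>UNIV. v $ q) = N * v $ p" for p
      unfolding sumN[symmetric] by (rule sum.cong) (auto intro: Lap_kernel[OF conn ker])
    then show ?thesis
      using N unfolding P vec_eq_iff by (metis nonzero_mult_div_cancel_left vec_lambda_beta)
  qed
  ultimately obtain X where X: "penrose (Lap \<Gamma>) X" "transpose X = X"
    using penrose_symmetric_exists[OF transpose_Lap] by blast
  then show "penrose (Lap \<Gamma>) (pinv (Lap \<Gamma>))" "transpose (pinv (Lap \<Gamma>)) = pinv (Lap \<Gamma>)"
    using pinv_eqI[OF X(1)] by simp_all
qed

section \<open>The objective as a sum of squared residuals\<close>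

lemma transpose_eps_kron_id_mult:
  fixes S :: "real^'d^('m::finite \<times> 'd)"
  shows "transpose (eps_kron_id i) ** S = block S i"
proof -
  have "(\<Sum>r\<in>UNIV. eps_kron_id i $ r $ a * S $ r $ b) = S $ (i, a) $ b" for a b
  proof -
    have "eps_kron_id i $ r $ a = (if r = (i, a) then 1 else 0)" for r :: "'m \<times> 'd"
      by (cases r) (auto simp: eps_kron_id_def axis_def mat_def)
    then show ?thesis
      by (simp add: if_distrib[of "\<lambda>y. y * _"] cong: if_cong)
  qed
  then show ?thesis
    by (simp add: block_def matrix_matrix_mult_def transpose_def vec_eq_iff)
qed

lemma transpose_mult_eps_kron_id: "transpose S ** eps_kron_id i = transpose (block S i)"
  by (metis matrix_transpose_mul transpose_eps_kron_id_mult transpose_transpose)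

text \<open>The matrix W of the overview: the least-squares solution of
  \<open>W *v evec k i = transpose (block S i) *v x k i\<close> over all edges. Its columns estimate
  the global positions of the points (\<open>Inl k\<close>) and the translations of the views
  (\<open>Inr i\<close>).\<close>

definition fitted :: "('n::finite \<times> 'm::finite) set \<Rightarrow> ('n \<Rightarrow> 'm \<Rightarrow> real^'d) \<Rightarrow>
    real^'d^('m \<times> 'd) \<Rightarrow> real^('n + 'm)^'d" where
  "fitted \<Gamma> x S = transpose S ** Bmat \<Gamma> x ** pinv (Lap \<Gamma>)"

lemma transpose_mult_Bmat:
  "transpose S ** Bmat \<Gamma> x = (\<Sum>(k, i)\<in>\<Gamma>. outer (transpose (block S i) *v x k i) (evec k i))"
  by (simp add: Bmat_def matrix_mult_sum matrix_mul_assoc transpose_mult_eps_kron_id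
      matrix_mult_outer matrix_vector_mul_assoc case_prod_beta)

text \<open>Expanding the squares gives a data term, which comes from \<open>Dmat\<close>, a cross
  term and a quadratic term. The last two sums are the same trace: the cross sum directly, the
  quadratic one as W L W^T, which reduces by the Penrose identity XLX = X and the symmetry of
  X.\<close>

lemma objective_eq_residual:
  fixes \<Gamma> :: "('n::finite \<times> 'm::finite) set"
  assumes conn: "bipartite_connected \<Gamma>"
  shows "objective \<Gamma> x S =
    (\<Sum>(k, i)\<in>\<Gamma>. (norm (transpose (block S i) *v x k i - fitted \<Gamma> x S *v evec k i))\<^sup>2)"
proof -
  define a where "a = (\<lambda>k i. transpose (block S i) *v x k i)"
  define W where "W = fitted \<Gamma> x S"
  define X where "X = pinv (Lap \<Gamma>)"
  have SB: "transpose S ** Bmat \<Gamma> x = (\<Sum>(k, i)\<in>\<Gamma>. outer (a k i) (evec k i))"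
    by (simp add: transpose_mult_Bmat a_def)
  have BS: "transpose (Bmat \<Gamma> x) ** S = (\<Sum>(k, i)\<in>\<Gamma>. outer (evec k i) (a k i))"
    using arg_cong[OF SB, of transpose]
    by (simp add: matrix_transpose_mul transpose_sum transpose_outer case_prod_beta)
  have "trace (transpose S ** Dmat \<Gamma> x ** S) = (\<Sum>(k, i)\<in>\<Gamma>. a k i \<bullet> a k i)"
  proof -
    have "transpose S ** (eps_kron_id i ** outer u u ** transpose (eps_kron_id i)) ** S =
      outer (transpose (block S i) *v u) (transpose (block S i) *v u)" for i u
    proof -
      have "transpose S ** (eps_kron_id i ** outer u u ** transpose (eps_kron_id i)) ** S =
        (transpose S ** eps_kron_id i) ** outer u u ** (transpose (eps_kron_id i) ** S)"
        by (simp add: matrix_mul_assoc)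
      then show ?thesis
        by (simp only: transpose_mult_eps_kron_id transpose_eps_kron_id_mult
            matrix_mult_outer outer_matrix_mult)
    qed
    then show ?thesis
      by (simp add: Dmat_def matrix_mult_sum sum_matrix_mult trace_sum trace_outer
          case_prod_beta a_def)
  qed
  moreover have "trace (transpose S ** Bmat \<Gamma> x ** X ** transpose (Bmat \<Gamma> x) ** S) =
      (\<Sum>(k, i)\<in>\<Gamma>. (W *v evec k i) \<bullet> a k i)"
  proof -
    have "transpose S ** Bmat \<Gamma> x ** X ** transpose (Bmat \<Gamma> x) ** S =
        W ** (transpose (Bmat \<Gamma> x) ** S)"
      by (simp add: W_def fitted_def X_def matrix_mul_assoc)
    then show ?thesis
      by (simp add: BS matrix_mult_sum matrix_mult_outer trace_sum trace_outer case_prod_beta)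
  qed
  moreover have "trace (transpose S ** Bmat \<Gamma> x ** X ** transpose (Bmat \<Gamma> x) ** S) =
      (\<Sum>(k, i)\<in>\<Gamma>. (W *v evec k i) \<bullet> (W *v evec k i))"
  proof -
    have "transpose W = X ** transpose (Bmat \<Gamma> x) ** S"
      using pinv_Lap(2)[OF conn]
      by (simp add: W_def fitted_def X_def matrix_transpose_mul matrix_mul_assoc)
    then have "W ** Lap \<Gamma> ** transpose W =
        transpose S ** Bmat \<Gamma> x ** (X ** Lap \<Gamma> ** X) ** transpose (Bmat \<Gamma> x) ** S"
      by (simp add: W_def fitted_def X_def matrix_mul_assoc)
    also have "X ** Lap \<Gamma> ** X = X"
      using pinv_Lap(1)[OF conn] by (simp add: X_def penrose_def)
    finally have "transpose S ** Bmat \<Gamma> x ** X ** transpose (Bmat \<Gamma> x) ** S =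
        W ** Lap \<Gamma> ** transpose W" ..
    then show ?thesis
      by (simp add: Lap_def matrix_mult_sum sum_matrix_mult matrix_mult_outer outer_matrix_mult
          trace_sum trace_outer case_prod_beta)
  qed
  moreover have "objective \<Gamma> x S = trace (transpose S ** Dmat \<Gamma> x ** S) -
      trace (transpose S ** Bmat \<Gamma> x ** X ** transpose (Bmat \<Gamma> x) ** S)"
    unfolding objective_def Cmat_def X_def
    by (subst trace_mul_sym)
      (simp add: matrix_mul_assoc matrix_sub_ldistrib matrix_sub_rdistrib trace_sub)
  \<comment> \<open>The subtracted trace is split as -2 + 1 times itself, with its cross form in the
    first place and its quadratic form in the second, to complete the square.\<close>
  ultimately have "objective \<Gamma> x S = (\<Sum>(k, i)\<in>\<Gamma>. a k i \<bullet> a k i) -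
      2 * (\<Sum>(k, i)\<in>\<Gamma>. (W *v evec k i) \<bullet> a k i) +
      (\<Sum>(k, i)\<in>\<Gamma>. (W *v evec k i) \<bullet> (W *v evec k i))"
    by simp
  also have "\<dots> = (\<Sum>(k, i)\<in>\<Gamma>. (norm (a k i - W *v evec k i))\<^sup>2)"
    by (simp add: case_prod_beta sum_distrib_left power2_norm_eq_inner inner_diff_left
        inner_diff_right inner_commute sum.distrib sum_subtractf)
  finally show ?thesis
    by (simp add: a_def W_def)
qed

lemma objective_nonneg: "bipartite_connected \<Gamma> \<Longrightarrow> 0 \<le> objective \<Gamma> x S"
  by (simp add: objective_eq_residual sum_nonneg case_prod_beta)

lemma matrix_vector_mult_evec: "W *v evec k i = column (Inl k) W - column (Inr i) W"
  by (simp add: evec_def matrix_vector_mult_diff_distrib matrix_vector_mult_basis)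

text \<open>A vanishing sum of squares has vanishing terms. The right-hand side does not involve
  \<open>i\<close>, so all views containing \<open>k\<close> place it at the same position.\<close>

lemma perfect_alignment_fit:
  assumes "bipartite_connected \<Gamma>" "objective \<Gamma> x S = 0" "(k, i) \<in> \<Gamma>"
  shows "transpose (block S i) *v x k i + column (Inr i) (fitted \<Gamma> x S) =
    column (Inl k) (fitted \<Gamma> x S)"
proof -
  have "norm (transpose (block S i) *v x k i - fitted \<Gamma> x S *v evec k i) = 0"
    using assms(2,3) unfolding objective_eq_residual[OF assms(1)]
    by (subst (asm) sum_nonneg_eq_0_iff) auto
  then show ?thesis
    by (simp add: matrix_vector_mult_evec algebra_simps)
qed

text \<open>The last factor of \<open>Hmat\<close> subtracts the mean of the point columns from
  every column. \<open>Hmat\<close> and \<open>fitted\<close> thus describe the same configuration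
  up to one common translation.\<close>

lemma column_Hmat:
  fixes \<Gamma> :: "('n::finite \<times> 'm::finite) set"
  obtains c where "\<And>p. column p (Hmat \<Gamma> x S) = column p (fitted \<Gamma> x S) - c"
proof -
  define f :: "real^('n + 'm)" where "f = (\<chi> p. case p of Inl k \<Rightarrow> 1 | Inr i \<Rightarrow> 0)"
  define W where "W = fitted \<Gamma> x S"
  have "Hmat \<Gamma> x S = W - (1 / real CARD('n)) *\<^sub>R outer (W *v f) (\<chi> p. 1)"
    unfolding Hmat_def fitted_def[symmetric] f_def[symmetric] W_def[symmetric]
    by (simp add: matrix_sub_ldistrib matrix_mult_scaleR matrix_mult_outer)
  then have "column p (Hmat \<Gamma> x S) = column p W - (1 / real CARD('n)) *\<^sub>R (W *v f)" for p
    by (simp add: column_def outer_def vec_eq_iff)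
  then show ?thesis
    using that W_def by blast
qed

section \<open>Overlaps and coarsening\<close>

lemma matrix_mult_rank_full_eq_0:
  fixes M :: "real^'b^'c" and A :: "real^'a^'b"
  assumes "rank A = CARD('b)" "M ** A = 0"
  shows "M = 0"
proof -
  have "M *v w = 0" for w
    using assms full_rank_surjective[of A]
    by (metis matrix_vector_mul_assoc matrix_vector_mult_0 surjD)
  then show ?thesis
    by (simp add: matrix_eq)
qed

lemma transpose_centering: "transpose (centering K) = centering K"
  by (simp add: centering_def outer_def transpose_def vec_eq_iff mat_def mult.commute)

lemma centering_indicator:
  fixes K :: "'n::finite set"
  shows "centering K *v (\<chi> k. indicator K k) = 0"
proof -
  have "(\<chi> k. indicator K k) \<bullet> (\<chi> k. (indicator K k :: real)) = real (card K)"
    by (simp add: inner_vec_def indicator_def if_distrib[of "\<lambda>y. y * _"] flip: sum.inter_filter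
        cong: if_cong)
  then show ?thesis
    \<comment> \<open>For empty \<open>K\<close> the quotient 1/0 is 0, but the indicator vector is
      itself zero. Otherwise the rank-one term maps the indicator to itself.\<close>
    by (cases "K = {}")
      (auto simp: centering_def matrix_vector_mult_diff_rdistrib scaleR_matrix_vector_assoc[symmetric]
        outer_matrix_vector_mult vec_eq_iff)
qed

text \<open>If \<open>M\<close> sends all common points to \<open>c\<close>, then \<open>M\<close>
  times the overlap matrix is the outer product of \<open>c\<close> with the indicator of the
  overlap. Centering annihilates this, and full rank forces \<open>M = 0\<close>. It will be applied
  to the difference of the linear parts of two motions.\<close>

lemma overlap_rigid:
  fixes z :: "'n::finite \<Rightarrow> 'v \<Rightarrow> real^'d" and M :: "real^'d^'c"
  assumes rank: "rank (overlap_mat P z u v ** centering (P u \<inter> P v)) = CARD('d)"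
    and const: "\<And>k. k \<in> P u \<inter> P v \<Longrightarrow> M *v z k u = c"
  shows "M = 0" "P u \<inter> P v \<noteq> {}"
proof -
  define K where "K = P u \<inter> P v"
  have "M ** overlap_mat P z u v = outer c (\<chi> k. indicator K k)"
  proof -
    have "(\<Sum>b\<in>UNIV. M $ a $ b * z k u $ b) = c $ a" if "k \<in> K" for a k
      using const[of k] that by (auto simp: K_def matrix_vector_mult_def vec_eq_iff)
    then show ?thesis
      by (auto simp: matrix_matrix_mult_def overlap_mat_def outer_def vec_eq_iff indicator_def
          simp flip: K_def)
  qed
  then have "M ** (overlap_mat P z u v ** centering K) = 0"
    by (simp add: matrix_mul_assoc outer_matrix_mult transpose_centering centering_indicator
        outer_zero_right)
  then show "M = 0"
    using rank matrix_mult_rank_full_eq_0 unfolding K_def by blast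
  \<comment> \<open>An empty overlap has rank 0, whereas \<open>CARD('d)\<close> is
    positive.\<close>
  show "P u \<inter> P v \<noteq> {}"
  proof
    assume "P u \<inter> P v = {}"
    then have "overlap_mat P z u v = 0"
      by (simp add: overlap_mat_def vec_eq_iff)
    then show False
      using rank by (simp add: rank_0)
  qed
qed

section \<open>Connected components, merging and termination of the coarsening\<close>

definition comp_of :: "('v \<times> 'v) set \<Rightarrow> 'v set \<Rightarrow> 'v \<Rightarrow> 'v set" where
  "comp_of R V u = {v \<in> V. (u, v) \<in> linked R}"

lemma comp_of_self: "u \<in> V \<Longrightarrow> u \<in> comp_of R V u"
  by (simp add: comp_of_def linked_def)

lemma comp_of_eq:
  assumes "v \<in> comp_of R V u"
  shows "comp_of R V v = comp_of R V u"
proof -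
  have "sym (linked R)"
    unfolding linked_def by (intro sym_rtrancl sym_Un_converse)
  moreover have "trans (linked R)"
    unfolding linked_def by (rule trans_rtrancl)
  moreover have "(u, v) \<in> linked R"
    using assms by (simp add: comp_of_def)
  ultimately show ?thesis
    unfolding comp_of_def by (blast dest: symD transD)
qed

text \<open>Indexing components by a representative presents the merged collection as the image of
  \<open>V\<close> under a single map, so its cardinality can be compared with that of
  \<open>V\<close>.\<close>

lemma merge_views_eq:
  "merge_views \<Gamma> x S V = (\<lambda>A. \<Union> (comp_of (snd (view_graph \<Gamma> x S V)) V A)) ` V"
proof -
  have "fst (view_graph \<Gamma> x S V) = V"
    by (simp add: view_graph_def overlap_graph_def)
  then show ?thesis
    unfolding merge_views_def conn_comps_def comp_of_def by auto
qed

text \<open>An image is never larger than \<open>V\<close>, and equal size would make the merging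
  map injective. Views in one component have the same image, so all components would be singletons
  and merging would change nothing.\<close>

lemma card_merge_views_less:
  assumes "merge_views \<Gamma> x S V \<noteq> V"
  shows "card (merge_views \<Gamma> x S V) < card V"
proof (rule ccontr)
  define R where "R = snd (view_graph \<Gamma> x S V)"
  define f where "f = (\<lambda>A. \<Union> (comp_of R V A))"
  have eq: "merge_views \<Gamma> x S V = f ` V"
    by (simp add: merge_views_eq R_def f_def)
  assume "\<not> card (merge_views \<Gamma> x S V) < card V"
  then have inj: "inj_on f V"
    unfolding eq using card_image_le[of V f] by (intro eq_card_imp_inj_on) auto
  have "f A = A" if A: "A \<in> V" for A
  proof -
    have "B = A" if B: "B \<in> comp_of R V A" for B
    proof (rule inj_onD[OF inj])
      show "f B = f A"
        unfolding f_def comp_of_eq[OF B] ..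
      show "B \<in> V"
        using B by (simp add: comp_of_def)
    qed (fact A)
    then have "comp_of R V A = {A}"
      using comp_of_self[OF A] by blast
    then show ?thesis
      by (simp add: f_def)
  qed
  then show False
    using assms unfolding eq by simp
qed

lemma Union_merge_views: "\<Union> (merge_views \<Gamma> x S V) = \<Union> V"
proof
  show "\<Union> (merge_views \<Gamma> x S V) \<subseteq> \<Union> V"
    unfolding merge_views_eq by (auto simp: comp_of_def)
  show "\<Union> V \<subseteq> \<Union> (merge_views \<Gamma> x S V)"
    unfolding merge_views_eq by (blast intro: comp_of_self)
qed

text \<open>The value of \<open>g\<close> on a view is compared through the image set, which
  \<open>linked_const\<close> transports along paths without choosing a representative in each
  view.\<close>

lemma merge_views_const:
  assumes edge: "\<And>A B. (A, B) \<in> snd (view_graph \<Gamma> x S V) \<Longrightarrow> g ` A = g ` B"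
    and const: "\<And>A i j. A \<in> V \<Longrightarrow> i \<in> A \<Longrightarrow> j \<in> A \<Longrightarrow> g i = g j"
    and "A \<in> merge_views \<Gamma> x S V" "i \<in> A" "j \<in> A"
  shows "g i = g j"
proof -
  define K where "K = comp_of (snd (view_graph \<Gamma> x S V)) V"
  obtain C where "A = \<Union> (K C)"
    using assms(3) unfolding merge_views_eq K_def by (rule imageE)
  then obtain D E where D: "D \<in> K C" "i \<in> D" and E: "E \<in> K C" "j \<in> E"
    using assms(4,5) by auto
  have img: "g ` C = g ` D" if "D \<in> K C" for D
  proof (rule linked_const[where f = "image g"])
    show "(C, D) \<in> linked (snd (view_graph \<Gamma> x S V))"
      using that by (simp add: K_def comp_of_def)
  qed (rule edge)
  have "g i \<in> g ` D"
    using D(2) by (rule imageI)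
  also have "g ` D = g ` E"
    using img[OF D(1)] img[OF E(1)] by (rule trans[OF sym])
  finally obtain h where h: "g i = g h" "h \<in> E"
    by (rule imageE)
  have "E \<in> V"
    using E(1) by (simp add: K_def comp_of_def)
  then have "g h = g j"
    using h(2) E(2) by (rule const)
  with h(1) show ?thesis
    by (rule trans)
qed

text \<open>Invariant rule for the coarsening loop, whose termination measure is the number of
  views.\<close>

lemma final_views_induct:
  assumes "Q (range (\<lambda>i. {i}))" and "\<And>V. Q V \<Longrightarrow> Q (merge_views \<Gamma> x S V)"
  shows "Q (final_views \<Gamma> x S)"
  unfolding final_views_def
proof (rule while_rule[where P = Q and Q = Q and r = "Wellfounded.measure card"])
  show "Q (range (\<lambda>i. {i}))"
    by (fact assms(1))
  show "Q (merge_views \<Gamma> x S V)" if "Q V" for V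
    using that by (fact assms(2))
  show "(merge_views \<Gamma> x S V, V) \<in> Wellfounded.measure card" if "merge_views \<Gamma> x S V \<noteq> V" for V
    using card_merge_views_less[OF that] by simp
qed simp_all

text \<open>No original view is lost in merging, so a single remaining view must contain all of
  them.\<close>

lemma Union_final_views: "\<Union> (final_views \<Gamma> x S) = UNIV"
  by (rule final_views_induct) (simp_all add: Union_merge_views)

text \<open>A pair \<open>g i\<close> encodes the affine map with linear part
  \<open>fst (g i)\<close> and translation \<open>snd (g i)\<close>. On the overlap the maps of
  \<open>A\<close> and \<open>B\<close> both send \<open>y k\<close> to \<open>w k\<close>, so their
  linear parts differ by a matrix that is constant there, hence zero. One common point then equates
  the translations.\<close>

lemma view_graph_edge_const:
  fixes g :: "'m::finite \<Rightarrow> (real^'d^'d) \<times> (real^'d)"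
  assumes coord: "\<And>k i. (k, i) \<in> \<Gamma> \<Longrightarrow> transformed \<Gamma> x S k i = y k"
    and motion: "\<And>k i. (k, i) \<in> \<Gamma> \<Longrightarrow> fst (g i) *v y k + snd (g i) = w k"
    and const: "\<And>A i j. A \<in> V \<Longrightarrow> i \<in> A \<Longrightarrow> j \<in> A \<Longrightarrow> g i = g j"
    and edge: "(A, B) \<in> snd (view_graph \<Gamma> x S V)"
  shows "g ` A = g ` B"
proof -
  let ?P = "merged_points \<Gamma>"
  let ?z = "merged_coord \<Gamma> x S"
  have AB: "A \<in> V" "B \<in> V"
    and rank: "rank (overlap_mat ?P ?z A B ** centering (?P A \<inter> ?P B)) = CARD('d)"
    using edge by (simp_all add: view_graph_def overlap_graph_def)
  have z: "?z k C = y k" if "k \<in> ?P C" for k C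
  proof -
    have "\<exists>i. i \<in> C \<and> (k, i) \<in> \<Gamma>"
      using that by (auto simp: merged_points_def)
    then have "(k, SOME i. i \<in> C \<and> (k, i) \<in> \<Gamma>) \<in> \<Gamma>"
      by (rule someI2_ex) blast
    then show ?thesis
      by (simp add: merged_coord_def coord)
  qed
  \<comment> \<open>The zero matrix and zero vector satisfy the constancy premise trivially, leaving
    only the nonemptiness of the overlap.\<close>
  obtain k where "k \<in> ?P A \<inter> ?P B"
    using overlap_rigid(2)[OF rank, of "0 :: real^'d^'d" 0] by auto
  then obtain i j where i: "i \<in> A" "(k, i) \<in> \<Gamma>" and j: "j \<in> B" "(k, j) \<in> \<Gamma>"
    by (auto simp: merged_points_def)
  have on_A: "fst (g i) *v y l + snd (g i) = w l" if "l \<in> ?P A" for l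
  proof -
    obtain h where h: "h \<in> A" "(l, h) \<in> \<Gamma>"
      using \<open>l \<in> ?P A\<close> by (auto simp: merged_points_def)
    show ?thesis
      unfolding const[OF AB(1) i(1) h(1)] by (rule motion[OF h(2)])
  qed
  have on_B: "fst (g j) *v y l + snd (g j) = w l" if "l \<in> ?P B" for l
  proof -
    obtain h where h: "h \<in> B" "(l, h) \<in> \<Gamma>"
      using \<open>l \<in> ?P B\<close> by (auto simp: merged_points_def)
    show ?thesis
      unfolding const[OF AB(2) j(1) h(1)] by (rule motion[OF h(2)])
  qed
  have "fst (g i) - fst (g j) = 0"
  proof (rule overlap_rigid(1)[OF rank])
    fix l assume "l \<in> ?P A \<inter> ?P B"
    then have l: "l \<in> ?P A" "l \<in> ?P B"
      by simp_all
    have "fst (g i) *v y l + snd (g i) = fst (g j) *v y l + snd (g j)"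
      unfolding on_A[OF l(1)] on_B[OF l(2)] ..
    then have "fst (g i) *v y l - fst (g j) *v y l = snd (g j) - snd (g i)"
      by (simp add: algebra_simps)
    then show "(fst (g i) - fst (g j)) *v ?z l A = snd (g j) - snd (g i)"
      unfolding z[OF l(1)] matrix_vector_mult_diff_rdistrib .
  qed
  then have fst_eq: "fst (g i) = fst (g j)"
    by simp
  have "fst (g i) *v y k + snd (g i) = fst (g j) *v y k + snd (g j)"
    unfolding motion[OF i(2)] motion[OF j(2)] ..
  then have "snd (g i) = snd (g j)"
    unfolding fst_eq by (rule add_left_imp_eq)
  with fst_eq have "g i = g j"
    by (rule prod_eqI)
  moreover have "g ` A = {g i}"
  proof -
    have "g ` A = (\<lambda>_. g i) ` A"
      using const[OF AB(1) _ i(1)] by (rule image_cong[OF refl])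
    also have "\<dots> = {g i}"
      using i(1) by (rule image_constant)
    finally show ?thesis .
  qed
  moreover have "g ` B = {g j}"
  proof -
    have "g ` B = (\<lambda>_. g j) ` B"
      using const[OF AB(2) _ j(1)] by (rule image_cong[OF refl])
    also have "\<dots> = {g j}"
      using j(1) by (rule image_constant)
    finally show ?thesis .
  qed
  ultimately show ?thesis
    by simp
qed

lemma final_views_const:
  fixes g :: "'m::finite \<Rightarrow> (real^'d^'d) \<times> (real^'d)"
  assumes "\<And>k i. (k, i) \<in> \<Gamma> \<Longrightarrow> transformed \<Gamma> x S k i = y k"
    and "\<And>k i. (k, i) \<in> \<Gamma> \<Longrightarrow> fst (g i) *v y k + snd (g i) = w k"
  shows "\<forall>A\<in>final_views \<Gamma> x S. \<forall>i\<in>A. \<forall>j\<in>A. g i = g j"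
proof (rule final_views_induct)
  fix V assume V: "\<forall>A\<in>V. \<forall>i\<in>A. \<forall>j\<in>A. g i = g j"
  have "g ` A = g ` B" if "(A, B) \<in> snd (view_graph \<Gamma> x S V)" for A B
    by (rule view_graph_edge_const[OF assms _ that]) (use V in blast)+
  then show "\<forall>A\<in>merge_views \<Gamma> x S V. \<forall>i\<in>A. \<forall>j\<in>A. g i = g j"
    by (intro ballI, elim merge_views_const[rotated 2]) (use V in blast)+
qed simp

section \<open>From a constant rigid motion to uniqueness\<close>

lemma block_mult: "block (S ** Q) i = block S i ** Q"
  by (simp add: block_def matrix_matrix_mult_def vec_eq_iff)

lemma block_inject: "(\<And>i. block S i = block T i) \<Longrightarrow> S = T"
  by (auto simp: block_def vec_eq_iff)

lemma perfect_alignments_congruent: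
  fixes \<Gamma> :: "('n::finite \<times> 'm::finite) set"
    and x :: "'n \<Rightarrow> 'm \<Rightarrow> real^'d"
  assumes conn: "bipartite_connected \<Gamma>"
    and S: "perfect_alignment \<Gamma> x S" and T: "perfect_alignment \<Gamma> x T"
    and one: "num_vertices (coarse_graph \<Gamma> x S) = 1"
  obtains Q where "orthogonal_matrix Q" "T = S ** Q"
proof -
  have S0: "objective \<Gamma> x S = 0" and T0: "objective \<Gamma> x T = 0"
    and orthS: "orthogonal_matrix (block S i)" and orthT: "orthogonal_matrix (block T i)" for i
    using S T by (simp_all add: perfect_alignment_def alignment_def)
  \<comment> \<open>Inverting \<open>y k = transpose (block S i) *v x k i + t i\<close> gives
    \<open>x k i = block S i *v (y k - t i)\<close>. Substituting this into the placement by
    \<open>T\<close> yields the linear part \<open>G i\<close> and the translation in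
    \<open>g i\<close>.\<close>
  define G where "G = (\<lambda>i. transpose (block T i) ** block S i)"
  define t where "t = (\<lambda>i. column (Inr i) (Hmat \<Gamma> x S))"
  define g where "g = (\<lambda>i. (G i, column (Inr i) (fitted \<Gamma> x T) - G i *v t i))"
  obtain c where c: "\<And>p. column p (Hmat \<Gamma> x S) = column p (fitted \<Gamma> x S) - c"
    using column_Hmat[of \<Gamma> x S] by blast
  define y where "y = (\<lambda>k. column (Inl k) (fitted \<Gamma> x S) - c)"
  have coord: "transformed \<Gamma> x S k i = y k" if "(k, i) \<in> \<Gamma>" for k i
    using perfect_alignment_fit[OF conn S0 that]
    by (simp add: transformed_def c y_def algebra_simps)
  have motion: "fst (g i) *v y k + snd (g i) = column (Inl k) (fitted \<Gamma> x T)"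
    if "(k, i) \<in> \<Gamma>" for k i
  proof -
    have "block S i ** transpose (block S i) = mat 1"
      using orthS by (simp add: orthogonal_matrix_def)
    then have "G i ** transpose (block S i) = transpose (block T i)"
      by (simp add: G_def flip: matrix_mul_assoc)
    then have "G i *v (y k - t i) = transpose (block T i) *v x k i"
      using coord[OF that, symmetric] by (simp add: transformed_def t_def matrix_vector_mul_assoc)
    then show ?thesis
      using perfect_alignment_fit[OF conn T0 that]
      by (simp add: g_def matrix_vector_mult_diff_distrib algebra_simps)
  qed
  obtain A where "final_views \<Gamma> x S = {A}"
    using one by (auto simp: num_vertices_def coarse_graph_def view_graph_def overlap_graph_def
        card_1_singleton_iff)
  then have "g i = g j" for i j
    using final_views_const[where g = g, OF coord motion] Union_final_views[of \<Gamma> x S] by auto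
  then have G: "G i = G j" for i j
    by (simp add: g_def)
  \<comment> \<open>All \<open>G i\<close> coincide, so any index serves. With this transpose,
    \<open>block S i ** Q\<close> is S_i S_i^T T_i, which is T_i by orthogonality.\<close>
  define Q where "Q = transpose (G undefined)"
  have orthQ: "orthogonal_matrix Q"
    unfolding Q_def G_def using orthS orthT
    by (simp add: orthogonal_matrix_mul orthogonal_matrix_transpose)
  have "block T i = block (S ** Q) i" for i
  proof -
    have "block S i ** Q = block S i ** transpose (block S i) ** block T i"
      unfolding Q_def G[of undefined i] by (simp add: G_def matrix_transpose_mul matrix_mul_assoc)
    then show ?thesis
      using orthS[of i] by (simp add: block_mult orthogonal_matrix_def)
  qed
  then show ?thesis
    using that orthQ block_inject by blast
qed

theorem theorem4p9:
  fixes \<Gamma> :: "('n::finite \<times> 'm::finite) set"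
    and x :: "'n \<Rightarrow> 'm \<Rightarrow> real^'d"
    and S :: "real^'d^('m \<times> 'd)"
  assumes "bipartite_connected \<Gamma>"
    and "\<And>i. affinely_nondegenerate \<Gamma> x i"
    and "perfect_alignment \<Gamma> x S"
    and "num_vertices (coarse_graph \<Gamma> x S) = 1"
  shows "unique_alignment \<Gamma> x S"
  unfolding unique_alignment_def
proof (intro conjI allI impI)
  show "optimal_alignment \<Gamma> x S"
    using assms(1,3) objective_nonneg
    by (auto simp: optimal_alignment_def perfect_alignment_def)
next
  fix T assume "optimal_alignment \<Gamma> x T"
  then have "perfect_alignment \<Gamma> x T"
    using assms(3) objective_nonneg[OF assms(1), of x T]
    by (force simp: optimal_alignment_def perfect_alignment_def)
  then show "\<exists>Q. orthogonal_matrix Q \<and> T = S ** Q"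
    using perfect_alignments_congruent[OF assms(1,3) _ assms(4)] by metis
qed

end
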